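(* If $X$ is a quasi-Polish space, then the convex (Vietoris) powerspace $\mathbf{L}(X)$ is quasi-Polish.
   Context: A subset $A$ of a topological space $Y$ is a $\mathbf{\Pi}^0_2$-subset if there are sequences $(U_i)_{i\in\omega}$ and $(V_i)_{i\in\omega}$ of open subsets of $Y$ such that $x\in A$ if and only if for all $i\in\omega$, $x\in U_i$ implies $x\in V_i$. A topological space is quasi-Polish if it is countably based and its topology is induced by a Smyth-complete quasi-metric; equivalently, if it is homeomorphic to a $\mathbf{\Pi}^0_2$-subset of an $\omega$-algebraic domain with the Scott topology (one may always take the domain to be $\mathcal{P}(\omega)$, the powerset of $\omega$ ordered by inclusion, with the Scott topology). Compactness means every open cover has a finite subcover (no separation axiom). A subset of a space is saturated if it equals the intersection of all its open neighborhoods. A subset $L\subseteq X$ is a lens if $L=A\cap K$ for some closed $A\subseteq X$ and some compact saturated $K\subseteq X$. The convex (or Vietoris) powerspace $\mathbf{L}(X)$ is the set of all lenses in $X$ with the Vietoris topology, which is generated by the sets $\Diamond U=\{L\in\mathbf{L}(X)\mid L\cap U\neq\emptyset\}$ and $\Box U=\{L\in\mathbf{L}(X)\mid L\subseteq U\}$ for $U\subseteq X$ open. *)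

theory Defs
  imports "HOL-Analysis.Analysis"
begin

definition quasi_metric_on :: "'a set \<Rightarrow> ('a \<Rightarrow> 'a \<Rightarrow> real) \<Rightarrow> bool" where
  "quasi_metric_on M d \<longleftrightarrow>
     (\<forall>x\<in>M. \<forall>y\<in>M. 0 \<le> d x y) \<and>
     (\<forall>x\<in>M. \<forall>y\<in>M. x = y \<longleftrightarrow> d x y = 0 \<and> d y x = 0) \<and>
     (\<forall>x\<in>M. \<forall>y\<in>M. \<forall>z\<in>M. d x z \<le> d x y + d y z)"

text \<open>The basic open sets are the balls \<open>{y. d x y < \<epsilon>}\<close>, with the centre as first argument.\<close>

definition quasi_metric_topology :: "'a set \<Rightarrow> ('a \<Rightarrow> 'a \<Rightarrow> real) \<Rightarrow> 'a topology" where
  "quasi_metric_topology M d =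
     topology (\<lambda>U. U \<subseteq> M \<and> (\<forall>x\<in>U. \<exists>\<epsilon>>0. {y \<in> M. d x y < \<epsilon>} \<subseteq> U))"

lemma openin_quasi_metric_topology:
  "openin (quasi_metric_topology M d) U \<longleftrightarrow>
     U \<subseteq> M \<and> (\<forall>x\<in>U. \<exists>\<epsilon>>0. {y \<in> M. d x y < \<epsilon>} \<subseteq> U)"
proof -
  have "istopology (\<lambda>U. U \<subseteq> M \<and> (\<forall>x\<in>U. \<exists>\<epsilon>>0. {y \<in> M. d x y < \<epsilon>} \<subseteq> U))"
  proof -
    have "\<exists>\<epsilon>>0. {y \<in> M. d x y < \<epsilon>} \<subseteq> S \<inter> T"
      if "\<exists>\<epsilon>>0. {y \<in> M. d x y < \<epsilon>} \<subseteq> S" "\<exists>\<epsilon>>0. {y \<in> M. d x y < \<epsilon>} \<subseteq> T" for S T x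
    proof -
      obtain a b where "a > 0" "{y \<in> M. d x y < a} \<subseteq> S" "b > 0" "{y \<in> M. d x y < b} \<subseteq> T"
        using \<open>\<exists>\<epsilon>>0. {y \<in> M. d x y < \<epsilon>} \<subseteq> S\<close> \<open>\<exists>\<epsilon>>0. {y \<in> M. d x y < \<epsilon>} \<subseteq> T\<close> by blast
      then show ?thesis
        by (intro exI[of _ "min a b"]) auto
    qed
    moreover have "\<exists>\<epsilon>>0. {y \<in> M. d x y < \<epsilon>} \<subseteq> \<Union>\<K>"
      if "S \<in> \<K>" "\<exists>\<epsilon>>0. {y \<in> M. d x y < \<epsilon>} \<subseteq> S" for S \<K> x
      using that by (meson Union_upper subset_trans)
    ultimately show ?thesis
      unfolding istopology_def by (simp add: Union_least le_infI1)
  qed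
  then show ?thesis
    by (simp add: quasi_metric_topology_def)
qed

definition quasi_metric_Cauchy :: "('a \<Rightarrow> 'a \<Rightarrow> real) \<Rightarrow> (nat \<Rightarrow> 'a) \<Rightarrow> bool" where
  "quasi_metric_Cauchy d s \<longleftrightarrow>
     (\<forall>\<epsilon>>0. \<exists>N. \<forall>m n. N \<le> m \<and> m \<le> n \<longrightarrow> d (s m) (s n) < \<epsilon>)"

text \<open>Smyth-completeness: every (forward) Cauchy sequence converges with respect to the
  symmetrized metric \<open>max (d x y) (d y x)\<close>, not merely in the quasi-metric topology.\<close>

definition Smyth_complete_on :: "'a set \<Rightarrow> ('a \<Rightarrow> 'a \<Rightarrow> real) \<Rightarrow> bool" where
  "Smyth_complete_on M d \<longleftrightarrow>
     (\<forall>s. range s \<subseteq> M \<and> quasi_metric_Cauchy d s \<longrightarrow>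
        (\<exists>x\<in>M. (\<lambda>n. max (d x (s n)) (d (s n) x)) \<longlonglongrightarrow> 0))"

definition quasi_Polish_space :: "'a topology \<Rightarrow> bool" where
  "quasi_Polish_space X \<longleftrightarrow>
     second_countable X \<and>
     (\<exists>d. quasi_metric_on (topspace X) d \<and> Smyth_complete_on (topspace X) d \<and>
          X = quasi_metric_topology (topspace X) d)"

definition saturated_in :: "'a topology \<Rightarrow> 'a set \<Rightarrow> bool" where
  "saturated_in X S \<longleftrightarrow> S \<subseteq> topspace X \<and> S = \<Inter>{U. openin X U \<and> S \<subseteq> U}"

text \<open>The empty set is a lens.\<close>

definition lenses :: "'a topology \<Rightarrow> 'a set set" where
  "lenses X = {A \<inter> K | A K. closedin X A \<and> compactin X K \<and> saturated_in X K}"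

definition Vietoris_diamond :: "'a topology \<Rightarrow> 'a set \<Rightarrow> 'a set set" where
  "Vietoris_diamond X U = {L \<in> lenses X. L \<inter> U \<noteq> {}}"

definition Vietoris_box :: "'a topology \<Rightarrow> 'a set \<Rightarrow> 'a set set" where
  "Vietoris_box X U = {L \<in> lenses X. L \<subseteq> U}"

definition convex_powerspace :: "'a topology \<Rightarrow> 'a set topology" where
  "convex_powerspace X =
     topology_generated_by
       ({Vietoris_diamond X U | U. openin X U} \<union> {Vietoris_box X U | U. openin X U})"

lemma topspace_convex_powerspace: "topspace (convex_powerspace X) = lenses X"
proof -
  have "L \<subseteq> topspace X" if "L \<in> lenses X" for L
    using that closedin_subset by (fastforce simp: lenses_def)
  then have "Vietoris_box X (topspace X) = lenses X"
    by (auto simp: Vietoris_box_def)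
  then have "lenses X \<in> {Vietoris_box X U | U. openin X U}"
    using openin_topspace by blast
  then have "lenses X \<subseteq> topspace (convex_powerspace X)"
    unfolding convex_powerspace_def topology_generated_by_topspace by (meson UnI2 Union_upper)
  moreover have "topspace (convex_powerspace X) \<subseteq> lenses X"
    unfolding convex_powerspace_def topology_generated_by_topspace
    by (auto simp: Vietoris_diamond_def Vietoris_box_def)
  ultimately show ?thesis
    by blast
qed

end

theory Submission
  imports Defs
begin

text \<open>
  Formal balls with centres in a countable set that is dense for the symmetrized metric give a
  countable base \<open>B\<close> of \<open>X\<close> and a relation \<open>a \<prec> b\<close> such that every \<open>\<prec>\<close>-chain of balls is a
  neighbourhood base of some point. Finite sets \<open>F\<close> of balls index a base of the powerspace: a lens
  belongs to the basic set of \<open>F\<close> if it is covered by \<open>F\<close> and meets every member of \<open>F\<close>. Order finite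
  sets by the Egli-Milner extension of \<open>\<prec>\<close>. A chain for this extension is a finitely branching
  tree; by Koenig's lemma the limits of its branches form a compact set, whose closure
  intersected with its saturation is the lens described by the chain.

  A Smyth-complete quasi-metric arises from the ranks ``first basic set in \<open>R i\<close> that contains
  \<open>y\<close>'' for countably many sets \<open>R i\<close> of indices: along a Cauchy sequence each rank is eventually
  non-increasing, hence eventually constant. The sets \<open>R i\<close> are chosen so that the basic sets that
  eventually contain a Cauchy sequence are directed for the Egli-Milner relation.
\<close>

section \<open>Koenig's lemma and branches through finite levels\<close>

text \<open>If no level worked, each \<open>K\<close> would have a branch \<open>q K\<close> that
  avoids \<open>P\<close> at level \<open>K\<close>. Pigeonhole on the finite levels extracts a
  branch \<open>p\<close> each of whose nodes lies on infinitely many \<open>q K\<close>. It meets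
  \<open>P\<close> at some \<open>k\<close>, and some \<open>q K\<close> with \<open>K\<close> \<ge>
  \<open>k\<close> through that node inherits \<open>P\<close> up to level \<open>K\<close>.\<close>

lemma Koenig_bar:
  fixes F :: "nat \<Rightarrow> 'b set"
  assumes fin: "\<And>k. finite (F k)"
    and mono: "\<And>a b. R a b \<Longrightarrow> P a \<Longrightarrow> P b"
    and bar: "\<And>p. (\<And>k. p k \<in> F k) \<Longrightarrow> (\<And>k. R (p k) (p (Suc k))) \<Longrightarrow> \<exists>k. P (p k)"
  shows "\<exists>K. \<forall>p. (\<forall>k. p k \<in> F k \<and> R (p k) (p (Suc k))) \<longrightarrow> P (p K)"
proof (rule ccontr)
  assume "\<not> ?thesis"
  then have "\<forall>K. \<exists>p. (\<forall>k. p k \<in> F k \<and> R (p k) (p (Suc k))) \<and> \<not> P (p K)"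
    by blast
  then obtain q where q: "\<And>K k. q K k \<in> F k" "\<And>K k. R (q K k) (q K (Suc k))" "\<And>K. \<not> P (q K K)"
    by metis
  have step: "\<exists>b. infinite {K\<in>S. q K k = b}" if "infinite S" for S k
  proof -
    have "finite ((\<lambda>K. q K k) ` S)"
      by (rule finite_subset[OF _ fin[of k]]) (use q(1) in blast)
    from pigeonhole_infinite[OF that this] show ?thesis by blast
  qed
  \<comment> \<open>The next node is chosen among the \<open>q K\<close> through the current one,
    which gives \<open>R\<close>; afterwards only the value at the new level is remembered, not the
    whole prefix.\<close>
  have "\<exists>p. \<forall>k. infinite {K. q K k = p k} \<and> R (p k) (p (Suc k))"
  proof (rule dependent_nat_choice)
    show "\<exists>x. infinite {K. q K 0 = x}"
      using step[of UNIV 0] by auto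
  next
    fix x k assume "infinite {K. q K k = x}"
    then obtain b where b: "infinite {K\<in>{K. q K k = x}. q K (Suc k) = b}"
      using step by blast
    then have "infinite {K. q K (Suc k) = b}"
      by (rule contrapos_nn) (erule rev_finite_subset, blast)
    moreover have "R x b"
      using infinite_imp_nonempty[OF b] q(2) by blast
    ultimately show "\<exists>y. infinite {K. q K (Suc k) = y} \<and> R x y"
      by blast
  qed
  then obtain p where p: "\<And>k. infinite {K. q K k = p k}" "\<And>k. R (p k) (p (Suc k))"
    by blast
  have "p k \<in> F k" for k
  proof -
    obtain K where "q K k = p k" using infinite_imp_nonempty[OF p(1)[of k]] by blast
    then show ?thesis using q(1)[of K k] by simp
  qed
  then obtain k where k: "P (p k)"
    using bar p(2) by blast
  obtain K where K: "K \<ge> k" "q K k = p k"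
    using p(1)[of k] unfolding infinite_nat_iff_unbounded_le by auto
  have "P (q K (k + j))" for j
    by (induction j) (use k K mono q(2) in auto)
  then have "P (q K K)"
    using K(1) by (metis le_add_diff_inverse)
  with q(3) show False by blast
qed

text \<open>\<open>succ\<close> extends \<open>b\<close> beyond level \<open>K\<close>, and
  \<open>pred\<close> supplies ancestors back to level 0. This turns bounds on branches, as given by
  \<open>Koenig_bar\<close>, into bounds on whole levels.\<close>

lemma branch_through:
  fixes F :: "nat \<Rightarrow> 'b set"
  assumes succ: "\<And>k a. a \<in> F k \<Longrightarrow> \<exists>b\<in>F (Suc k). R a b"
    and pred: "\<And>k b. b \<in> F (Suc k) \<Longrightarrow> \<exists>a\<in>F k. R a b"
    and "b \<in> F K"
  shows "\<exists>p. p K = b \<and> (\<forall>k. p k \<in> F k \<and> R (p k) (p (Suc k)))"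
proof -
  have "\<exists>t. \<forall>j. (t j \<in> F (K + j) \<and> (j = 0 \<longrightarrow> t j = b)) \<and> R (t j) (t (Suc j))"
    by (rule dependent_nat_choice) (use succ \<open>b \<in> F K\<close> in auto)
  then obtain t where t: "t 0 = b" "\<And>j. t j \<in> F (K + j)" "\<And>j. R (t j) (t (Suc j))"
    by blast
  \<comment> \<open>The tail \<open>t\<close> is generalized: the induction step prepends a parent
    of \<open>t 0\<close> and treats \<open>case_nat a t\<close> as a tail that starts one level
    earlier.\<close>
  have "\<exists>p. (\<forall>k. p k \<in> F k \<and> R (p k) (p (Suc k))) \<and> (\<forall>j. p (K + j) = t j)"
    if "\<And>j. t j \<in> F (K + j)" "\<And>j. R (t j) (t (Suc j))" for t K
    using that
  proof (induction K arbitrary: t)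
    case 0
    then show ?case by (intro exI[of _ t]) auto
  next
    case (Suc K)
    obtain a where a: "a \<in> F K" "R a (t 0)"
      using pred Suc.prems(1)[of 0] by auto
    have 1: "case_nat a t j \<in> F (K + j)" for j
      using a Suc.prems(1) by (cases j) auto
    have 2: "R (case_nat a t j) (case_nat a t (Suc j))" for j
      using a Suc.prems(2) by (cases j) auto
    obtain p where p: "\<forall>k. p k \<in> F k \<and> R (p k) (p (Suc k))" "\<forall>j. p (K + j) = case_nat a t j"
      using Suc.IH[of "case_nat a t", OF 1 2] by blast
    have "p (Suc K + j) = t j" for j
      using p(2)[rule_format, of "Suc j"] by simp
    with p(1) show ?case by blast
  qed
  from this[of t K, OF t(2,3)] obtain p
    where "\<forall>k. p k \<in> F k \<and> R (p k) (p (Suc k))" "\<forall>j. p (K + j) = t j"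
    by blast
  then show ?thesis
    using t(1) by (metis add_0_right)
qed

section \<open>Smyth-complete quasi-metrics from ranks\<close>

text \<open>Singletons among the \<open>R i\<close> let \<open>d\<close> see every basic set, so
  that \<open>d\<close> induces the topology. The remaining \<open>R i\<close> restrict, through the
  premises of \<open>lim\<close>, the families \<open>I\<close> for which a limit point has to be
  supplied.\<close>

lemma quasi_Polish_spaceI_ranks:
  fixes Y :: "'y topology" and N :: "'n::countable \<Rightarrow> 'y set" and R :: "'i::countable \<Rightarrow> 'n set"
  assumes opN: "\<And>n. openin Y (N n)"
    and base: "\<And>U x. openin Y U \<Longrightarrow> x \<in> U \<Longrightarrow> \<exists>n. x \<in> N n \<and> N n \<subseteq> U"
    and T0: "\<And>x y. x \<in> topspace Y \<Longrightarrow> y \<in> topspace Y \<Longrightarrow> (\<And>n. x \<in> N n \<longleftrightarrow> y \<in> N n) \<Longrightarrow> x = y"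
    and single: "\<And>n. \<exists>i. R i = {n}"
    and lim: "\<And>s I. range s \<subseteq> topspace Y \<Longrightarrow>
       (\<And>n. if n \<in> I then \<forall>\<^sub>F k in sequentially. s k \<in> N n else \<forall>\<^sub>F k in sequentially. s k \<notin> N n) \<Longrightarrow>
       (\<And>i. R i \<inter> I \<noteq> {} \<or> (\<forall>\<^sub>F k in sequentially. s k \<notin> (\<Union>n\<in>R i. N n))) \<Longrightarrow>
       \<exists>y\<in>topspace Y. \<forall>n. y \<in> N n \<longleftrightarrow> n \<in> I"
  shows "quasi_Polish_space Y"
proof -
  define M where "M = topspace Y"
  \<comment> \<open>\<open>le i x y\<close> says that the rank of \<open>y\<close> in \<open>R i\<close> is at most that of \<open>x\<close>.\<close>
  define le where "le i x y \<longleftrightarrow> (\<forall>n\<in>R i. x \<in> N n \<longrightarrow> (\<exists>m\<in>R i. to_nat m \<le> to_nat n \<and> y \<in> N m))" for i x y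
  define d :: "'y \<Rightarrow> 'y \<Rightarrow> real" where
    "d x y = (if \<forall>i. le i x y then 0 else (1/2) ^ (LEAST k. \<exists>i. to_nat i = k \<and> \<not> le i x y))" for x y
  have le_trans: "le i x z" if "le i x y" "le i y z" for i x y z
    unfolding le_def
  proof (intro ballI impI)
    fix n assume "n \<in> R i" "x \<in> N n"
    then obtain m where m: "m \<in> R i" "to_nat m \<le> to_nat n" "y \<in> N m"
      using \<open>le i x y\<close> unfolding le_def by blast
    then obtain l where "l \<in> R i" "to_nat l \<le> to_nat m" "z \<in> N l"
      using \<open>le i y z\<close> unfolding le_def by blast
    then show "\<exists>m\<in>R i. to_nat m \<le> to_nat n \<and> z \<in> N m"
      using m(2) by (intro bexI[of _ l]) auto
  qed
  have le_refl: "le i x x" for i x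
    unfolding le_def by blast
  have d_nonneg: "0 \<le> d x y" for x y
    unfolding d_def by auto
  \<comment> \<open>The bound is inclusive: the exponent in \<open>d\<close> is the first code at
    which \<open>le\<close> fails, and it exceeds \<open>n\<close> exactly when all codes up to and
    including \<open>n\<close> pass.\<close>
  have d_lt: "d x y < (1/2) ^ n \<longleftrightarrow> (\<forall>i. to_nat i \<le> n \<longrightarrow> le i x y)" for x y n
  proof (cases "\<forall>i. le i x y")
    case False
    let ?Q = "\<lambda>k. \<exists>i. to_nat i = k \<and> \<not> le i x y"
    have ex: "\<exists>k. ?Q k" using False by blast
    have "d x y < (1/2) ^ n \<longleftrightarrow> n < (LEAST k. ?Q k)"
      using False unfolding d_def by (auto simp: power_strict_decreasing_iff)
    also have "\<dots> \<longleftrightarrow> (\<forall>k\<le>n. \<not> ?Q k)"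
    proof
      assume "n < (LEAST k. ?Q k)"
      then show "\<forall>k\<le>n. \<not> ?Q k" using not_less_Least[of _ ?Q] le_less_trans by blast
    next
      assume "\<forall>k\<le>n. \<not> ?Q k"
      then show "n < (LEAST k. ?Q k)" using LeastI_ex[OF ex] not_le by blast
    qed
    finally show ?thesis by blast
  qed (simp add: d_def)
  have d_cases: "d x y = 0 \<or> (\<exists>i. d x y = (1/2) ^ to_nat i \<and> \<not> le i x y)" for x y
  proof (cases "\<forall>i. le i x y")
    case False
    then have "\<exists>k i. to_nat i = k \<and> \<not> le i x y" by blast
    from LeastI_ex[OF this] obtain i
      where "to_nat i = (LEAST k. \<exists>i. to_nat i = k \<and> \<not> le i x y)" "\<not> le i x y" by blast
    then show ?thesis
      using False unfolding d_def by metis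
  qed (simp add: d_def)
  have d_small: "\<exists>n. (1/2) ^ n < \<epsilon>" if "\<epsilon> > 0" for \<epsilon> :: real
    using real_arch_pow_inv[OF that, of "1/2"] by auto
  \<comment> \<open>Transitivity of \<open>le\<close> at the first failing index bounds
    \<open>d x z\<close> even by the larger of the two distances.\<close>
  have tri: "d x z \<le> d x y + d y z" for x y z
    using d_cases[of x z]
  proof
    assume "\<exists>i. d x z = (1/2) ^ to_nat i \<and> \<not> le i x z"
    then obtain i where i: "d x z = (1/2) ^ to_nat i" "\<not> le i x z" by blast
    then have "\<not> le i x y \<or> \<not> le i y z" using le_trans by blast
    then have "d x z \<le> d x y \<or> d x z \<le> d y z"
      using d_lt[of x y "to_nat i"] d_lt[of y z "to_nat i"] i(1) by force
    then show ?thesis using d_nonneg[of x y] d_nonneg[of y z] by linarith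
  qed (use d_nonneg[of x y] d_nonneg[of y z] in linarith)
  have d_zero: "le i x y" if "d x y = 0" for i x y
    using d_lt[of x y "to_nat i"] that by simp
  have N_of_zero: "y \<in> N n" if "d x y = 0" "x \<in> N n" for x y n
  proof -
    obtain i where "R i = {n}" using single by blast
    then show ?thesis using d_zero[OF that(1), of i] that(2) by (simp add: le_def)
  qed
  have qm: "quasi_metric_on M d"
    unfolding quasi_metric_on_def
  proof (intro conjI ballI)
    fix x y assume "x \<in> M" "y \<in> M"
    show "x = y \<longleftrightarrow> d x y = 0 \<and> d y x = 0"
    proof
      assume "x = y" then show "d x y = 0 \<and> d y x = 0"
        using le_refl by (simp add: d_def)
    next
      assume "d x y = 0 \<and> d y x = 0"
      then show "x = y"
        using T0[of x y] N_of_zero \<open>x \<in> M\<close> \<open>y \<in> M\<close> unfolding M_def by blast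
    qed
  qed (use d_nonneg tri in auto)
  \<comment> \<open>If the rank of \<open>x\<close> is attained at \<open>n\<close>, all points of
    \<open>N n\<close> have at most that rank; if \<open>x\<close> has no rank in
    \<open>R i\<close>, the whole space serves.\<close>
  have open_le: "\<exists>V. openin Y V \<and> x \<in> V \<and> V \<subseteq> {y\<in>M. le i x y}" if "x \<in> M" for i x
  proof (cases "\<exists>n\<in>R i. x \<in> N n")
    case True
    then obtain n where n: "n \<in> R i" "x \<in> N n"
      and min: "\<And>m. m \<in> R i \<Longrightarrow> x \<in> N m \<Longrightarrow> to_nat n \<le> to_nat m"
      using ex_has_least_nat[of "\<lambda>n. n \<in> R i \<and> x \<in> N n" _ to_nat] by blast
    have "N n \<subseteq> {y\<in>M. le i x y}"
      using openin_subset[OF opN[of n]] n min unfolding M_def le_def by blast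
    then show ?thesis using opN n by blast
  next
    case False
    then show ?thesis
      by (intro exI[of _ M]) (use that in \<open>auto simp: M_def le_def\<close>)
  qed
  have open_ball: "\<exists>V. openin Y V \<and> x \<in> V \<and> V \<subseteq> {y\<in>M. d x y < \<epsilon>}" if "x \<in> M" "\<epsilon> > 0" for x \<epsilon>
  proof -
    obtain n where n: "(1/2) ^ n < \<epsilon>" using d_small \<open>\<epsilon> > 0\<close> by blast
    obtain V where V: "\<And>i. openin Y (V i)" "\<And>i. x \<in> V i" "\<And>i. V i \<subseteq> {y\<in>M. le i x y}"
      using open_le[OF \<open>x \<in> M\<close>] by metis
    define J where "J = {i::'i. to_nat i \<le> n}"
    have "finite J"
      unfolding J_def using finite_vimageI[of "{..n}" "to_nat :: 'i \<Rightarrow> nat"] by (simp add: vimage_def)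
    then have "finite (insert M (V ` J))" by blast
    then have op: "openin Y (\<Inter>(insert M (V ` J)))"
      by (rule openin_Inter) (use V(1) in \<open>auto simp: M_def\<close>)
    have "\<Inter>(insert M (V ` J)) \<subseteq> {y\<in>M. d x y < \<epsilon>}"
    proof
      fix y assume "y \<in> \<Inter>(insert M (V ` J))"
      then have y: "y \<in> M" "\<And>i. to_nat i \<le> n \<Longrightarrow> le i x y"
        using V(3) unfolding J_def by auto
      then have "d x y < (1/2) ^ n" using d_lt by blast
      then show "y \<in> {y\<in>M. d x y < \<epsilon>}" using n y(1) by auto
    qed
    then show ?thesis using op V(2) \<open>x \<in> M\<close> by blast
  qed
  have "openin Y U \<longleftrightarrow> openin (quasi_metric_topology M d) U" for U
    unfolding openin_quasi_metric_topology
  proof (intro iffI conjI ballI)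
    assume U: "openin Y U"
    show "U \<subseteq> M" unfolding M_def using U by (rule openin_subset)
    fix x assume "x \<in> U"
    then obtain n where n: "x \<in> N n" "N n \<subseteq> U" using base U by blast
    obtain i where i: "R i = {n}" using single by blast
    have "{y\<in>M. d x y < (1/2) ^ to_nat i} \<subseteq> U"
    proof
      fix y assume "y \<in> {y\<in>M. d x y < (1/2) ^ to_nat i}"
      then have "le i x y" using d_lt by blast
      then show "y \<in> U" using n i unfolding le_def by auto
    qed
    then show "\<exists>\<epsilon>>0. {y\<in>M. d x y < \<epsilon>} \<subseteq> U"
      by (intro exI[of _ "(1/2) ^ to_nat i"]) simp
  next
    assume "U \<subseteq> M \<and> (\<forall>x\<in>U. \<exists>\<epsilon>>0. {y \<in> M. d x y < \<epsilon>} \<subseteq> U)"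
    then have "\<exists>V. openin Y V \<and> x \<in> V \<and> V \<subseteq> U" if "x \<in> U" for x
      using open_ball that by (meson subset_eq)
    then show "openin Y U"
      by (subst openin_subopen) blast
  qed
  then have top: "Y = quasi_metric_topology M d"
    by (simp add: topology_eq)
  have "Smyth_complete_on M d"
    unfolding Smyth_complete_on_def
  proof (intro allI impI, elim conjE)
    fix s assume sM: "range s \<subseteq> M" and cau: "quasi_metric_Cauchy d s"
    have mono: "\<exists>K. \<forall>m n. K \<le> m \<and> m \<le> n \<longrightarrow> le i (s m) (s n)" for i
    proof -
      obtain K where "\<forall>m n. K \<le> m \<and> m \<le> n \<longrightarrow> d (s m) (s n) < (1/2) ^ to_nat i"
        using cau unfolding quasi_metric_Cauchy_def by (meson zero_less_power half_gt_zero zero_less_one)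
      then show ?thesis using d_lt by blast
    qed
    \<comment> \<open>Either the tail from \<open>K\<close> on has no rank in \<open>R i\<close>, or
      \<open>n\<close> is the least index that it meets. Once \<open>n\<close> is met,
      \<open>le\<close> keeps the rank from rising, minimality keeps it from falling, and
      injectivity of \<open>to_nat\<close> fixes the index.\<close>
    have stable: "(\<forall>\<^sub>F k in sequentially. s k \<notin> (\<Union>n\<in>R i. N n)) \<or>
        (\<exists>n\<in>R i. \<forall>\<^sub>F k in sequentially. s k \<in> N n \<and>
           (\<forall>m\<in>R i. s k \<in> N m \<longrightarrow> to_nat n \<le> to_nat m))" for i
    proof -
      obtain K where K: "\<And>m n. K \<le> m \<Longrightarrow> m \<le> n \<Longrightarrow> le i (s m) (s n)"
        using mono by blast
      show ?thesis
      proof (cases "\<exists>n. n \<in> R i \<and> (\<exists>k\<ge>K. s k \<in> N n)")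
        case True
        then obtain n where n: "n \<in> R i" "\<exists>k\<ge>K. s k \<in> N n"
          and min: "\<And>m. m \<in> R i \<and> (\<exists>k\<ge>K. s k \<in> N m) \<Longrightarrow> to_nat n \<le> to_nat m"
          using ex_has_least_nat[of "\<lambda>n. n \<in> R i \<and> (\<exists>k\<ge>K. s k \<in> N n)" _ to_nat] by blast
        then obtain k where k: "k \<ge> K" "s k \<in> N n" by blast
        have "s j \<in> N n \<and> (\<forall>m\<in>R i. s j \<in> N m \<longrightarrow> to_nat n \<le> to_nat m)" if "j \<ge> k" for j
        proof -
          obtain m where m: "m \<in> R i" "to_nat m \<le> to_nat n" "s j \<in> N m"
            using K[OF k(1) \<open>j \<ge> k\<close>] n(1) k(2) unfolding le_def by blast
          moreover have "j \<ge> K" using that k by simp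
          ultimately have "to_nat m = to_nat n" using min[of m] by force
          then have "m = n" by simp
          then show ?thesis using m min \<open>j \<ge> K\<close> by blast
        qed
        then show ?thesis using n(1) unfolding eventually_sequentially by blast
      next
        case False
        then show ?thesis unfolding eventually_sequentially by blast
      qed
    qed
    define I where "I = {n. \<forall>\<^sub>F k in sequentially. s k \<in> N n}"
    have "\<exists>y\<in>topspace Y. \<forall>n. y \<in> N n \<longleftrightarrow> n \<in> I"
    proof (rule lim)
      show "range s \<subseteq> topspace Y" using sM M_def by simp
      show "if n \<in> I then \<forall>\<^sub>F k in sequentially. s k \<in> N n else \<forall>\<^sub>F k in sequentially. s k \<notin> N n" for n
      proof -
        obtain i where i: "R i = {n}" using single by blast
        show ?thesis using stable[of i] unfolding i I_def by (auto elim: eventually_mono)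
      qed
      show "R i \<inter> I \<noteq> {} \<or> (\<forall>\<^sub>F k in sequentially. s k \<notin> (\<Union>n\<in>R i. N n))" for i
        using stable[of i] unfolding I_def by (auto elim: eventually_mono)
    qed
    then obtain y where y: "y \<in> M" "\<And>n. y \<in> N n \<longleftrightarrow> n \<in> I" unfolding M_def by blast
    \<comment> \<open>Since \<open>y\<close> lies in exactly those basic sets that eventually
      contain the sequence, its rank is the eventual rank of \<open>s k\<close>; equal ranks give
      \<open>le\<close> in both directions.\<close>
    have conv: "\<forall>\<^sub>F k in sequentially. le i y (s k) \<and> le i (s k) y" for i
      using stable[of i]
    proof
      assume A: "\<forall>\<^sub>F k in sequentially. s k \<notin> (\<Union>n\<in>R i. N n)"
      have "y \<notin> N n" if "n \<in> R i" for n
      proof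
        assume "y \<in> N n"
        then have "\<forall>\<^sub>F k in sequentially. s k \<in> N n" using y(2) I_def by blast
        with A have "\<forall>\<^sub>F k in sequentially. False"
          by eventually_elim (use that in blast)
        then show False by simp
      qed
      then show ?thesis using A by (auto elim!: eventually_mono simp: le_def)
    next
      assume "\<exists>n\<in>R i. \<forall>\<^sub>F k in sequentially. s k \<in> N n \<and>
           (\<forall>m\<in>R i. s k \<in> N m \<longrightarrow> to_nat n \<le> to_nat m)"
      then obtain n where n: "n \<in> R i" and A: "\<forall>\<^sub>F k in sequentially. s k \<in> N n \<and>
           (\<forall>m\<in>R i. s k \<in> N m \<longrightarrow> to_nat n \<le> to_nat m)" by blast
      have "\<forall>\<^sub>F k in sequentially. s k \<in> N n"
        using A by eventually_elim blast
      then have yn: "y \<in> N n" using y(2) unfolding I_def by blast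
      have ymin: "to_nat n \<le> to_nat m" if "m \<in> R i" "y \<in> N m" for m
      proof -
        have "\<forall>\<^sub>F k in sequentially. s k \<in> N m" using y(2) that I_def by blast
        with A have "\<forall>\<^sub>F k in sequentially. to_nat n \<le> to_nat m"
          by eventually_elim (use that in blast)
        then show ?thesis by simp
      qed
      from A show ?thesis
        by eventually_elim (use n yn ymin in \<open>auto simp: le_def\<close>)
    qed
    have "(\<lambda>n. max (d y (s n)) (d (s n) y)) \<longlonglongrightarrow> 0"
    proof (rule tendstoI)
      fix \<epsilon> :: real assume "\<epsilon> > 0"
      then obtain n where n: "(1/2) ^ n < \<epsilon>" using d_small by blast
      have "finite {i::'i. to_nat i \<le> n}"
        using finite_vimageI[of "{..n}" "to_nat :: 'i \<Rightarrow> nat"] by (simp add: vimage_def)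
      then have "\<forall>\<^sub>F k in sequentially. \<forall>i\<in>{i. to_nat i \<le> n}. le i y (s k) \<and> le i (s k) y"
        using conv by (intro eventually_ball_finite) auto
      then show "\<forall>\<^sub>F k in sequentially. dist (max (d y (s k)) (d (s k) y)) 0 < \<epsilon>"
      proof eventually_elim
        case (elim k)
        then have "d y (s k) < (1/2) ^ n" "d (s k) y < (1/2) ^ n" using d_lt by auto
        then show ?case using n d_nonneg[of y "s k"] by (simp add: dist_real_def max_def)
      qed
    qed
    then show "\<exists>x\<in>M. (\<lambda>n. max (d x (s n)) (d (s n) x)) \<longlonglongrightarrow> 0"
      using y(1) by blast
  qed
  moreover have "second_countable Y"
    unfolding second_countable_def
    by (intro exI[of _ "range N"]) (use opN base in \<open>auto simp: countableI_type\<close>)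
  ultimately show ?thesis
    unfolding quasi_Polish_space_def M_def[symmetric] using qm top by (intro conjI exI[of _ d])
qed

section \<open>Bases whose chains converge\<close>

definition chain_limit :: "'a topology \<Rightarrow> ('b \<Rightarrow> 'a set) \<Rightarrow> (nat \<Rightarrow> 'b) \<Rightarrow> 'a \<Rightarrow> bool" where
  "chain_limit X B p x \<longleftrightarrow> (\<forall>k. x \<in> B (p k)) \<and> (\<forall>U. openin X U \<and> x \<in> U \<longrightarrow> (\<exists>k. B (p k) \<subseteq> U))"

text \<open>An abstraction of formal balls. For empty \<open>S\<close>, \<open>refine\<close> is the
  base property; otherwise it also interpolates simultaneously inside finitely many given balls.
  \<open>chain\<close> is the form of completeness that the tree argument consumes.\<close>

locale convergent_base =
  fixes X :: "'a topology" and B :: "'b::countable \<Rightarrow> 'a set" and prec :: "'b \<Rightarrow> 'b \<Rightarrow> bool"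
  assumes open_B: "openin X (B b)"
    and prec_subset: "prec a b \<Longrightarrow> B b \<subseteq> B a"
    and refine: "openin X U \<Longrightarrow> x \<in> U \<Longrightarrow> finite S \<Longrightarrow> (\<And>a. a \<in> S \<Longrightarrow> x \<in> B a) \<Longrightarrow>
       \<exists>b. x \<in> B b \<and> B b \<subseteq> U \<and> (\<forall>a\<in>S. prec a b)"
    and chain: "(\<And>k. prec (p k) (p (Suc k))) \<Longrightarrow> \<exists>x. chain_limit X B p x"

section \<open>Lenses and their open neighbourhoods\<close>

lemma lens_compactin: "L \<in> lenses X \<Longrightarrow> compactin X L"
  unfolding lenses_def by (auto intro: closed_Int_compactin)

lemma openin_diamond: "openin X U \<Longrightarrow> openin (convex_powerspace X) (Vietoris_diamond X U)"
  unfolding convex_powerspace_def by (rule topology_generated_by_Basis) blast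

lemma openin_box: "openin X U \<Longrightarrow> openin (convex_powerspace X) (Vietoris_box X U)"
  unfolding convex_powerspace_def by (rule topology_generated_by_Basis) blast

text \<open>A lens is recovered from the open sets that it meets and those that contain it: a point
  outside the closed part is excluded by the diamond of the complement, a point outside the
  saturated part by the box of a neighbourhood of that part. Used in both directions, this is the T0
  property of the powerspace.\<close>

lemma lens_subsetI:
  assumes L: "L \<in> lenses X" and M: "M \<in> lenses X"
    and same: "\<And>U. openin (convex_powerspace X) U \<Longrightarrow> L \<in> U \<longleftrightarrow> M \<in> U"
  shows "M \<subseteq> L"
proof
  fix x assume x: "x \<in> M"
  obtain A K where AK: "L = A \<inter> K" "closedin X A" "saturated_in X K"
    using L unfolding lenses_def by blast
  have xX: "x \<in> topspace X" using lens_compactin[OF M] x compactin_subset_topspace by blast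
  have "x \<in> A"
  proof (rule ccontr)
    assume "x \<notin> A"
    then have "M \<in> Vietoris_diamond X (topspace X - A)"
      using M x xX by (auto simp: Vietoris_diamond_def)
    then have "L \<in> Vietoris_diamond X (topspace X - A)"
      using same[OF openin_diamond[of X "topspace X - A"]] AK(2) by (simp add: openin_diff)
    then show False using AK(1) by (auto simp: Vietoris_diamond_def)
  qed
  moreover have "x \<in> U" if "openin X U" "K \<subseteq> U" for U
  proof -
    have "L \<in> Vietoris_box X U" using L AK(1) that by (auto simp: Vietoris_box_def)
    then have "M \<in> Vietoris_box X U" using same[OF openin_box[OF that(1)]] by blast
    then show ?thesis using x by (auto simp: Vietoris_box_def)
  qed
  then have "x \<in> K" using AK(3) unfolding saturated_in_def by blast
  ultimately show "x \<in> L" using AK(1) by blast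
qed

text \<open>The hull is the closure of \<open>C\<close> intersected with its saturation
  \<open>K\<close>. \<open>C\<close> and \<open>K\<close> have the same open supersets, so
  compactness passes to \<open>K\<close>; \<open>C\<close> and its closure meet the same open sets.
  The hull lies between \<open>C\<close> and each of them.\<close>

lemma compact_lens_hull:
  assumes "compactin X C"
  obtains L where "L \<in> lenses X" "\<And>U. openin X U \<Longrightarrow> L \<subseteq> U \<longleftrightarrow> C \<subseteq> U"
    "\<And>U. openin X U \<Longrightarrow> L \<inter> U \<noteq> {} \<longleftrightarrow> C \<inter> U \<noteq> {}"
proof
  define K where "K = \<Inter>{U. openin X U \<and> C \<subseteq> U}"
  have CX: "C \<subseteq> topspace X" using assms compactin_subset_topspace by blast
  have CK: "C \<subseteq> K" unfolding K_def by blast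
  have KX: "K \<subseteq> topspace X" unfolding K_def using CX by blast
  have KU: "K \<subseteq> U \<longleftrightarrow> C \<subseteq> U" if "openin X U" for U
    using CK that unfolding K_def by blast
  have "compactin X K"
    unfolding compactin_def
  proof (intro conjI allI impI KX)
    fix \<U> assume \<U>: "Ball \<U> (openin X) \<and> K \<subseteq> \<Union> \<U>"
    then have "C \<subseteq> \<Union>\<U>" using CK by blast
    then obtain \<F> where \<F>: "finite \<F>" "\<F> \<subseteq> \<U>" "C \<subseteq> \<Union>\<F>"
      using assms \<U> unfolding compactin_def by meson
    then have "K \<subseteq> \<Union>\<F>" using KU[of "\<Union>\<F>"] \<U> by blast
    then show "\<exists>\<F>. finite \<F> \<and> \<F> \<subseteq> \<U> \<and> K \<subseteq> \<Union> \<F>" using \<F> by blast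
  qed
  moreover have "saturated_in X K"
    unfolding saturated_in_def using KX KU K_def by auto
  ultimately show "X closure_of C \<inter> K \<in> lenses X"
    unfolding lenses_def using closedin_closure_of by blast
  have C: "C \<subseteq> X closure_of C \<inter> K" using CK closure_of_subset[OF CX] by blast
  show "X closure_of C \<inter> K \<subseteq> U \<longleftrightarrow> C \<subseteq> U" if "openin X U" for U
    using C KU[OF that] by blast
  show "X closure_of C \<inter> K \<inter> U \<noteq> {} \<longleftrightarrow> C \<inter> U \<noteq> {}" if "openin X U" for U
    using C openin_Int_closure_of_eq_empty[OF that, of C] by blast
qed

section \<open>The Egli-Milner base of the powerspace\<close>

context convergent_base
begin

text \<open>Lists encode finite sets so that the type of indices is countable. The empty list
  approximates only the empty set, which accounts for the empty lens.\<close>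

definition approximates :: "'b list \<Rightarrow> 'a set \<Rightarrow> bool" where
  "approximates F L \<longleftrightarrow> L \<subseteq> (\<Union>a\<in>set F. B a) \<and> (\<forall>a\<in>set F. L \<inter> B a \<noteq> {})"

definition Egli_Milner :: "'b list \<Rightarrow> 'b list \<Rightarrow> bool" where
  "Egli_Milner F G \<longleftrightarrow> (\<forall>b\<in>set G. \<exists>a\<in>set F. prec a b) \<and> (\<forall>a\<in>set F. \<exists>b\<in>set G. prec a b)"

lemma approximates_antimono:
  assumes FG: "Egli_Milner F G" and G: "approximates G L"
  shows "approximates F L"
  unfolding approximates_def
proof (intro conjI ballI subsetI)
  fix x assume "x \<in> L"
  then obtain b where b: "b \<in> set G" "x \<in> B b"
    using G unfolding approximates_def by blast
  then obtain a where "a \<in> set F" "prec a b"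
    using FG unfolding Egli_Milner_def by blast
  then show "x \<in> (\<Union>a\<in>set F. B a)"
    using b prec_subset by blast
next
  fix a assume "a \<in> set F"
  then obtain b where b: "b \<in> set G" "prec a b"
    using FG unfolding Egli_Milner_def by blast
  then have "L \<inter> B b \<noteq> {}" using G unfolding approximates_def by blast
  then show "L \<inter> B a \<noteq> {}" using prec_subset[OF b(2)] by blast
qed

text \<open>Interpolation: the approximations of a compact set are directed, and they can be taken
  inside any open neighbourhood. Compactness gives a finite cover by good balls; one further good
  ball for each member of each \<open>F\<close> secures the second half of
  \<open>Egli_Milner\<close>.\<close>

lemma ex_approximation:
  assumes L: "compactin X L" and W: "openin X W" "L \<subseteq> W"
    and Fs: "\<And>F. F \<in> set Fs \<Longrightarrow> approximates F L"
  shows "\<exists>G. approximates G L \<and> (\<forall>F\<in>set Fs. Egli_Milner F G) \<and> (\<forall>b\<in>set G. B b \<subseteq> W)"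
proof -
  define good where "good b \<longleftrightarrow> B b \<subseteq> W \<and> L \<inter> B b \<noteq> {} \<and> (\<forall>F\<in>set Fs. \<exists>a\<in>set F. prec a b)" for b
  \<comment> \<open>The set \<open>S\<close> serves two ends: it is empty for the cover, and
    \<open>{a}\<close> for the ball that must refine a given \<open>a\<close>.\<close>
  have ex_good: "\<exists>b. good b \<and> x \<in> B b \<and> (\<forall>a\<in>S. prec a b)"
    if x: "x \<in> L" and S: "finite S" "\<And>a. a \<in> S \<Longrightarrow> x \<in> B a" for x S
  proof -
    have "\<forall>F\<in>set Fs. \<exists>a\<in>set F. x \<in> B a"
      using Fs x unfolding approximates_def by blast
    then obtain f where f: "\<And>F. F \<in> set Fs \<Longrightarrow> f F \<in> set F \<and> x \<in> B (f F)"
      by metis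
    have "\<exists>b. x \<in> B b \<and> B b \<subseteq> W \<and> (\<forall>a\<in>S \<union> f ` set Fs. prec a b)"
      by (rule refine) (use W x S f in auto)
    then show ?thesis unfolding good_def using x f by blast
  qed
  have "\<forall>x\<in>L. \<exists>b. good b \<and> x \<in> B b"
    using ex_good[of _ "{}"] by blast
  then have "L \<subseteq> \<Union>(B ` Collect good)" by blast
  moreover have "\<And>U. U \<in> B ` Collect good \<Longrightarrow> openin X U"
    using open_B by blast
  ultimately obtain \<F> where \<F>: "finite \<F>" "\<F> \<subseteq> B ` Collect good" "L \<subseteq> \<Union>\<F>"
    using L unfolding compactin_def by meson
  obtain C where C: "finite C" "C \<subseteq> Collect good" "\<F> = B ` C"
    using finite_subset_image[OF \<F>(1,2)] by blast
  define A where "A = (\<Union>F\<in>set Fs. set F)"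
  have "\<forall>a\<in>A. \<exists>b. good b \<and> prec a b"
  proof
    fix a assume "a \<in> A"
    then obtain x where "x \<in> L" "x \<in> B a"
      using Fs unfolding approximates_def A_def by blast
    then show "\<exists>b. good b \<and> prec a b" using ex_good[of x "{a}"] by blast
  qed
  then obtain g where g: "\<And>a. a \<in> A \<Longrightarrow> good (g a) \<and> prec a (g a)"
    by metis
  have "finite (C \<union> g ` A)" using C unfolding A_def by blast
  then obtain G where G: "set G = C \<union> g ` A"
    using finite_list by blast
  have goodG: "good b" if "b \<in> set G" for b
    using that G C g by blast
  have "approximates G L"
    unfolding approximates_def using goodG G \<F>(3) C(3) by (auto simp: good_def)
  moreover have "Egli_Milner F G" if "F \<in> set Fs" for F
    unfolding Egli_Milner_def using goodG that g G unfolding A_def good_def by blast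
  ultimately show ?thesis
    using goodG good_def by blast
qed

definition basic_open :: "'b list \<Rightarrow> 'a set set" where
  "basic_open F = {L \<in> lenses X. approximates F L}"

lemma openin_basic_open: "openin (convex_powerspace X) (basic_open F)"
proof -
  have "openin (convex_powerspace X)
      (\<Inter>(insert (Vietoris_box X (\<Union>a\<in>set F. B a)) ((\<lambda>a. Vietoris_diamond X (B a)) ` set F)))"
    by (rule openin_Inter) (auto intro!: openin_box openin_diamond open_B)
  moreover have "\<Inter>(insert (Vietoris_box X (\<Union>a\<in>set F. B a)) ((\<lambda>a. Vietoris_diamond X (B a)) ` set F)) =
      basic_open F"
    by (auto simp: basic_open_def approximates_def Vietoris_box_def Vietoris_diamond_def)
  ultimately show ?thesis by simp
qed

lemma basic_open_base:
  assumes "openin (convex_powerspace X) \<U>" and "L \<in> \<U>"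
  shows "\<exists>F. L \<in> basic_open F \<and> basic_open F \<subseteq> \<U>"
proof -
  have "generate_topology_on
      ({Vietoris_diamond X U | U. openin X U} \<union> {Vietoris_box X U | U. openin X U}) \<U>"
    using assms(1) unfolding convex_powerspace_def openin_topology_generated_by_iff .
  then show ?thesis using assms(2)
  proof (induction rule: generate_topology_on.induct)
    case Empty
    then show ?case by simp
  next
    case (Int \<V> \<W>)
    then obtain F G where F: "L \<in> basic_open F" "basic_open F \<subseteq> \<V>"
      and G: "L \<in> basic_open G" "basic_open G \<subseteq> \<W>" by blast
    have L: "L \<in> lenses X" using F unfolding basic_open_def by blast
    obtain H where "approximates H L" "\<forall>F\<in>set [F, G]. Egli_Milner F H"
      using ex_approximation[OF lens_compactin[OF L] openin_topspace
          compactin_subset_topspace[OF lens_compactin[OF L]], of "[F, G]"] F(1) G(1)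
      unfolding basic_open_def by auto
    then have "L \<in> basic_open H" "basic_open H \<subseteq> basic_open F" "basic_open H \<subseteq> basic_open G"
      using L approximates_antimono unfolding basic_open_def by auto
    then show ?case using F G by blast
  next
    case (UN \<K>)
    then show ?case by blast
  next
    case (Basis \<V>)
    then consider U where "openin X U" "\<V> = Vietoris_diamond X U"
      | U where "openin X U" "\<V> = Vietoris_box X U" by blast
    then show ?case
    proof cases
      case 1
      then have L: "L \<in> lenses X" using Basis.prems by (simp add: Vietoris_diamond_def)
      obtain x where x: "x \<in> L" "x \<in> U"
        using 1 Basis.prems by (auto simp: Vietoris_diamond_def)
      obtain b where b: "x \<in> B b" "B b \<subseteq> U"
        using refine[OF 1(1) x(2), of "{}"] by auto
      obtain G where "approximates G L"
        using ex_approximation[OF lens_compactin[OF L] openin_topspace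
            compactin_subset_topspace[OF lens_compactin[OF L]], of "[]"] by auto
      \<comment> \<open>Adding \<open>b\<close> to any approximation of \<open>L\<close> preserves
        the cover and forces every lens in the new basic set to meet \<open>B b\<close>, hence
        \<open>U\<close>.\<close>
      then have "L \<in> basic_open (b # G)"
        using L x b unfolding basic_open_def approximates_def by auto
      moreover have "basic_open (b # G) \<subseteq> \<V>"
        using b unfolding 1 basic_open_def approximates_def Vietoris_diamond_def by auto
      ultimately show ?thesis by blast
    next
      case 2
      then have L: "L \<in> lenses X" "L \<subseteq> U" using Basis.prems by (auto simp: Vietoris_box_def)
      obtain G where "approximates G L" "\<forall>b\<in>set G. B b \<subseteq> U"
        using ex_approximation[OF lens_compactin[OF L(1)] 2(1) L(2), of "[]"] by auto
      then have "L \<in> basic_open G" "basic_open G \<subseteq> \<V>"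
        using L unfolding 2 basic_open_def approximates_def Vietoris_box_def by blast+
      then show ?thesis by blast
    qed
  qed
qed

lemma basic_open_separates:
  assumes "L \<in> lenses X" "M \<in> lenses X" and same: "\<And>F. L \<in> basic_open F \<longleftrightarrow> M \<in> basic_open F"
  shows "L = M"
proof -
  have "L \<in> \<U> \<longleftrightarrow> M \<in> \<U>" if "openin (convex_powerspace X) \<U>" for \<U>
    using basic_open_base[OF that] same by blast
  then show ?thesis using lens_subsetI assms by (metis subset_antisym)
qed

text \<open>The lens is the hull of the set \<open>C\<close> of limits of branches. The last clause
  says that the levels \<open>F k\<close> are cofinal among all its approximations, so the chain
  describes a neighbourhood base of the lens.\<close>

lemma lens_of_chain:
  assumes EM: "\<And>k. Egli_Milner (F k) (F (Suc k))"
  shows "\<exists>L\<in>lenses X. (\<forall>k. approximates (F k) L) \<and>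
    (\<forall>G. approximates G L \<longrightarrow> (\<exists>k. \<forall>M. approximates (F k) M \<longrightarrow> approximates G M))"
proof -
  define branch where "branch p \<longleftrightarrow> (\<forall>k. p k \<in> set (F k) \<and> prec (p k) (p (Suc k)))" for p
  define C where "C = {x. \<exists>p. branch p \<and> chain_limit X B p x}"
  have branch_mono: "B (p j) \<subseteq> B (p k)" if "branch p" "k \<le> j" for p k j
    using \<open>k \<le> j\<close>
  proof (induction rule: dec_induct)
    case (step n)
    have "prec (p n) (p (Suc n))" using that(1) unfolding branch_def by blast
    then show ?case using prec_subset step.IH by blast
  qed simp
  have through: "\<exists>p. branch p \<and> p k = b" if "b \<in> set (F k)" for b k
    using branch_through[of "\<lambda>k. set (F k)" prec b k] that EM
    unfolding Egli_Milner_def branch_def by blast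
  have lim: "\<exists>x\<in>C. chain_limit X B p x" if "branch p" for p
    using chain[of p] that unfolding C_def branch_def by blast
  have FC: "approximates (F k) C" for k
    unfolding approximates_def
  proof (intro conjI ballI subsetI)
    fix x assume "x \<in> C"
    then show "x \<in> (\<Union>a\<in>set (F k). B a)"
      unfolding C_def branch_def chain_limit_def by blast
  next
    fix a assume "a \<in> set (F k)"
    then obtain p where "branch p" "p k = a" using through by blast
    then show "C \<inter> B a \<noteq> {}"
      using lim[of p] unfolding chain_limit_def by blast
  qed
  \<comment> \<open>Every branch has a limit in \<open>C\<close>, so one of its balls fits into a
    member of the cover. \<open>Koenig_bar\<close> makes the level uniform.\<close>
  have bar: "\<exists>K. \<forall>a\<in>set (F K). \<exists>U\<in>\<U>. B a \<subseteq> U"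
    if "\<And>U. U \<in> \<U> \<Longrightarrow> openin X U" "C \<subseteq> \<Union>\<U>" for \<U>
  proof -
    have "\<exists>K. \<forall>p. (\<forall>k. p k \<in> set (F k) \<and> prec (p k) (p (Suc k))) \<longrightarrow> (\<exists>U\<in>\<U>. B (p K) \<subseteq> U)"
    proof (rule Koenig_bar)
      show "\<exists>U\<in>\<U>. B b \<subseteq> U" if "prec a b" "\<exists>U\<in>\<U>. B a \<subseteq> U" for a b
        using that prec_subset by blast
    next
      fix p assume "\<And>k. p k \<in> set (F k)" "\<And>k. prec (p k) (p (Suc k))"
      then have "branch p" unfolding branch_def by blast
      then obtain x where x: "x \<in> C" "chain_limit X B p x" using lim by blast
      then obtain U where "U \<in> \<U>" "x \<in> U" using \<open>C \<subseteq> \<Union>\<U>\<close> by blast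
      then show "\<exists>k. \<exists>U\<in>\<U>. B (p k) \<subseteq> U"
        using x(2) \<open>\<And>U. U \<in> \<U> \<Longrightarrow> openin X U\<close> unfolding chain_limit_def by blast
    qed auto
    \<comment> \<open>Each member of \<open>F K\<close> lies on a branch, so the bound holds for the
      entire level.\<close>
    then show ?thesis using through unfolding branch_def by metis
  qed
  have "compactin X C"
    unfolding compactin_def
  proof (intro conjI allI impI)
    show "C \<subseteq> topspace X"
      using FC[of 0] openin_subset[OF open_B] unfolding approximates_def by blast
  next
    fix \<U> assume \<U>: "Ball \<U> (openin X) \<and> C \<subseteq> \<Union> \<U>"
    then obtain K where "\<forall>a\<in>set (F K). \<exists>U\<in>\<U>. B a \<subseteq> U" using bar by blast
    then obtain f where f: "\<And>a. a \<in> set (F K) \<Longrightarrow> f a \<in> \<U> \<and> B a \<subseteq> f a" by metis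
    have "C \<subseteq> \<Union>(f ` set (F K))"
      using FC[of K] f unfolding approximates_def by blast
    then show "\<exists>\<F>. finite \<F> \<and> \<F> \<subseteq> \<U> \<and> C \<subseteq> \<Union> \<F>"
      using f by (intro exI[of _ "f ` set (F K)"]) auto
  qed
  then obtain L where L: "L \<in> lenses X" "\<And>U. openin X U \<Longrightarrow> L \<subseteq> U \<longleftrightarrow> C \<subseteq> U"
    "\<And>U. openin X U \<Longrightarrow> L \<inter> U \<noteq> {} \<longleftrightarrow> C \<inter> U \<noteq> {}"
    using compact_lens_hull by blast
  have op: "openin X (\<Union>a\<in>set G. B a)" for G using open_B by blast
  have LC: "approximates G L \<longleftrightarrow> approximates G C" for G
    unfolding approximates_def using L(2)[OF op[of G]] L(3)[OF open_B] by simp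
  have "\<exists>k. \<forall>M. approximates (F k) M \<longrightarrow> approximates G M" if G: "approximates G C" for G
  proof -
    \<comment> \<open>The covering half of \<open>G\<close> follows from \<open>bar\<close> for the
      single open set formed by the union of \<open>G\<close>; the meeting half needs one branch for
      each member of \<open>G\<close>, whose limit lies in that ball.\<close>
    obtain K where K: "\<forall>a\<in>set (F K). \<exists>U\<in>{\<Union>a\<in>set G. B a}. B a \<subseteq> U"
      using bar[of "{\<Union>a\<in>set G. B a}"] op[of G] G unfolding approximates_def by auto
    have "\<exists>p k. branch p \<and> B (p k) \<subseteq> B a" if "a \<in> set G" for a
    proof -
      have "C \<inter> B a \<noteq> {}" using G that unfolding approximates_def by blast
      then obtain x where x: "x \<in> C" "x \<in> B a" by blast
      then obtain p where p: "branch p" "chain_limit X B p x" unfolding C_def by blast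
      then obtain k where "B (p k) \<subseteq> B a"
        using open_B[of a] x(2) unfolding chain_limit_def by blast
      with p(1) show ?thesis by blast
    qed
    then obtain k p where kp: "\<And>a. a \<in> set G \<Longrightarrow> branch (p a) \<and> B (p a (k a)) \<subseteq> B a"
      by metis
    define J where "J = Max (insert K (k ` set G))"
    have J: "K \<le> J" "\<And>a. a \<in> set G \<Longrightarrow> k a \<le> J"
      unfolding J_def by auto
    have "approximates G M" if M: "approximates (F J) M" for M
      unfolding approximates_def
    proof (intro conjI ballI subsetI)
      fix x assume "x \<in> M"
      then obtain b where b: "b \<in> set (F J)" "x \<in> B b"
        using M unfolding approximates_def by blast
      then obtain q where q: "branch q" "q J = b" using through by blast
      then have "x \<in> B (q K)" using branch_mono[OF q(1) J(1)] b by blast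
      moreover have "q K \<in> set (F K)" using q(1) branch_def by blast
      ultimately show "x \<in> (\<Union>a\<in>set G. B a)" using K by blast
    next
      fix a assume a: "a \<in> set G"
      have "B (p a J) \<subseteq> B a" "p a J \<in> set (F J)"
        using kp[OF a] branch_mono[of "p a", OF _ J(2)[OF a]] branch_def by blast+
      then show "M \<inter> B a \<noteq> {}" using M unfolding approximates_def by blast
    qed
    then show ?thesis by blast
  qed
  then show ?thesis using L(1) FC LC by blast
qed

lemma quasi_Polish_convex_powerspace: "quasi_Polish_space (convex_powerspace X)"
proof -
  \<comment> \<open>\<open>Inr\<close> yields the required singletons. \<open>Inl Fs\<close>
    collects the common refinements of \<open>Fs\<close>; its rank forces \<open>I\<close> to be
    directed.\<close>
  define R :: "'b list list + 'b list \<Rightarrow> 'b list set" where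
    "R = case_sum (\<lambda>Fs. {G. \<forall>F\<in>set Fs. Egli_Milner F G}) (\<lambda>F. {F})"
  show ?thesis
  proof (rule quasi_Polish_spaceI_ranks[where N = basic_open and R = R])
    show "\<exists>i. R i = {F}" for F
      by (rule exI[of _ "Inr F"]) (simp add: R_def)
  next
    fix s and I :: "'b list set"
    assume s: "range s \<subseteq> topspace (convex_powerspace X)"
      and I: "\<And>F. if F \<in> I then \<forall>\<^sub>F k in sequentially. s k \<in> basic_open F
                 else \<forall>\<^sub>F k in sequentially. s k \<notin> basic_open F"
      and RI: "\<And>i. R i \<inter> I \<noteq> {} \<or> (\<forall>\<^sub>F k in sequentially. s k \<notin> (\<Union>F\<in>R i. basic_open F))"
    have sl: "s k \<in> lenses X" for k using s by (auto simp: topspace_convex_powerspace)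
    \<comment> \<open>Eventually \<open>s k\<close> lies in all basic sets of \<open>Fs\<close>, and
      interpolation puts it into a basic set of some common refinement. It therefore cannot
      eventually avoid all of \<open>R (Inl Fs)\<close>.\<close>
    have directed: "\<exists>G\<in>I. \<forall>F\<in>set Fs. Egli_Milner F G" if Fs: "set Fs \<subseteq> I" for Fs
    proof (rule ccontr)
      assume "\<not> ?thesis"
      then have "R (Inl Fs) \<inter> I = {}" by (auto simp: R_def)
      then have "\<forall>\<^sub>F k in sequentially. s k \<notin> (\<Union>F\<in>R (Inl Fs). basic_open F)" using RI by blast
      moreover have "\<forall>\<^sub>F k in sequentially. \<forall>F\<in>set Fs. s k \<in> basic_open F"
        using Fs I by (intro eventually_ball_finite) (auto split: if_splits)
      ultimately have "\<forall>\<^sub>F k in sequentially. False"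
      proof eventually_elim
        case (elim k)
        have "compactin X (s k)" using sl lens_compactin by blast
        from ex_approximation[OF this openin_topspace compactin_subset_topspace[OF this], of Fs]
        show ?case using elim sl by (auto simp: basic_open_def R_def)
      qed
      then show False by simp
    qed
    obtain G0 where "G0 \<in> I" using directed[of "[]"] by auto
    then obtain e :: "nat \<Rightarrow> 'b list" where e: "range e = I"
      using range_from_nat_into[of I] by (metis countableI_type empty_iff)
    \<comment> \<open>A chain inside \<open>I\<close> that is cofinal in it: stage
      \<open>Suc k\<close> refines both the previous stage and the \<open>k\<close>-th element of
      \<open>I\<close>.\<close>
    have "\<exists>G. \<forall>k. G k \<in> I \<and> (Egli_Milner (G k) (G (Suc k)) \<and> Egli_Milner (e k) (G (Suc k)))"
    proof (rule dependent_nat_choice)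
      show "\<exists>G. G \<in> I" using \<open>G0 \<in> I\<close> by blast
      show "\<exists>H. H \<in> I \<and> Egli_Milner G H \<and> Egli_Milner (e k) H" if "G \<in> I" for G k
        using directed[of "[G, e k]"] that e by auto
    qed
    then obtain G where G: "\<And>k. G k \<in> I" "\<And>k. Egli_Milner (G k) (G (Suc k))"
        "\<And>k. Egli_Milner (e k) (G (Suc k))" by blast
    obtain L where L: "L \<in> lenses X" "\<And>k. approximates (G k) L"
      "\<And>F. approximates F L \<Longrightarrow> \<exists>k. \<forall>M. approximates (G k) M \<longrightarrow> approximates F M"
      using lens_of_chain[of G, OF G(2)] by blast
    have "L \<in> basic_open F \<longleftrightarrow> F \<in> I" for F
    proof
      assume "L \<in> basic_open F"
      then obtain k where k: "\<And>M. approximates (G k) M \<Longrightarrow> approximates F M"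
        using L(3) unfolding basic_open_def by blast
      have "\<forall>\<^sub>F j in sequentially. s j \<in> basic_open (G k)" using I[of "G k"] G(1) by simp
      then have ev: "\<forall>\<^sub>F j in sequentially. s j \<in> basic_open F"
        by eventually_elim (use k in \<open>auto simp: basic_open_def\<close>)
      show "F \<in> I"
      proof (rule ccontr)
        assume "F \<notin> I"
        then have "\<forall>\<^sub>F j in sequentially. s j \<notin> basic_open F" using I[of F] by simp
        with ev have "\<forall>\<^sub>F j in sequentially. False" by eventually_elim simp
        then show False by simp
      qed
    next
      assume "F \<in> I"
      then obtain k where "F = e k" using e by blast
      then show "L \<in> basic_open F"
        using approximates_antimono[OF G(3)] L(1,2) unfolding basic_open_def by blast
    qed
    then show "\<exists>L\<in>topspace (convex_powerspace X). \<forall>F. L \<in> basic_open F \<longleftrightarrow> F \<in> I"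
      using L(1) by (auto simp: topspace_convex_powerspace)
  qed (use openin_basic_open basic_open_base basic_open_separates in
      \<open>auto simp: topspace_convex_powerspace\<close>)
qed

end

section \<open>Formal balls of a Smyth-complete quasi-metric\<close>

text \<open>If \<open>x\<close> and \<open>z\<close> both lie in a basic set \<open>V\<close> that
  is contained in the ball of radius \<open>(1/2) ^ k\<close> around each of them, they are close in
  both directions. Hence one such point for each \<open>V\<close> and \<open>k\<close>
  suffices.\<close>

lemma symmetrized_separable:
  assumes qm: "quasi_metric_on M d" and sc: "second_countable (quasi_metric_topology M d)"
  obtains c :: "nat \<Rightarrow> 'a" where
    "\<And>x \<epsilon>. x \<in> M \<Longrightarrow> \<epsilon> > 0 \<Longrightarrow> \<exists>n. c n \<in> M \<and> d x (c n) < \<epsilon> \<and> d (c n) x < \<epsilon>"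
proof -
  let ?X = "quasi_metric_topology M d"
  obtain \<B> where \<B>: "countable \<B>"
    "\<forall>U x. openin ?X U \<and> x \<in> U \<longrightarrow> (\<exists>V\<in>\<B>. x \<in> V \<and> V \<subseteq> U)"
    using sc unfolding second_countable_def by metis
  have d0: "d x x = 0" if "x \<in> M" for x
    using qm that unfolding quasi_metric_on_def by blast
  have tri: "d x z \<le> d x y + d y z" if "x \<in> M" "y \<in> M" "z \<in> M" for x y z
    using qm that unfolding quasi_metric_on_def by blast
  have ball: "openin ?X {y\<in>M. d x y < \<epsilon>}" if "x \<in> M" for x \<epsilon>
    unfolding openin_quasi_metric_topology
  proof (intro conjI ballI)
    fix y assume y: "y \<in> {y\<in>M. d x y < \<epsilon>}"
    have "d x z < \<epsilon>" if "z \<in> M" "d y z < \<epsilon> - d x y" for z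
      using tri[of x y z] that y \<open>x \<in> M\<close> by simp
    then show "\<exists>\<epsilon>'>0. {z\<in>M. d y z < \<epsilon>'} \<subseteq> {z\<in>M. d x z < \<epsilon>}"
      using y by (intro exI[of _ "\<epsilon> - d x y"]) auto
  qed auto
  define P where "P V k x \<longleftrightarrow> x \<in> V \<and> V \<subseteq> {y\<in>M. d x y < (1/2) ^ k}" for V and k :: nat and x
  \<comment> \<open>Where no point satisfies \<open>P V k\<close>, \<open>SOME\<close> is arbitrary
    and may leave \<open>M\<close>; this is why the conclusion asks for \<open>c n\<close> in
    \<open>M\<close>.\<close>
  define D where "D = (\<lambda>(V, k). SOME x. P V k x) ` (\<B> \<times> UNIV)"
  have "countable D" unfolding D_def using \<B>(1) by auto
  have dense: "\<exists>z\<in>D. z \<in> M \<and> d x z < \<epsilon> \<and> d z x < \<epsilon>" if x: "x \<in> M" "\<epsilon> > 0" for x \<epsilon>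
  proof -
    obtain k where k: "(1/2) ^ k < \<epsilon>"
      using real_arch_pow_inv[OF x(2), of "1/2"] by auto
    obtain V where V: "V \<in> \<B>" "x \<in> V" "V \<subseteq> {y\<in>M. d x y < (1/2) ^ k}"
      using \<B>(2)[rule_format, of "{y\<in>M. d x y < (1/2) ^ k}" x] ball[OF x(1)] x(1) d0 by auto
    define z where "z = (SOME z. P V k z)"
    have "P V k x" using V unfolding P_def by blast
    then have "P V k z" unfolding z_def by (rule someI)
    then have "z \<in> M" "d x z < (1/2) ^ k" "d z x < (1/2) ^ k"
      using V unfolding P_def by blast+
    moreover have "z \<in> D" unfolding D_def z_def using V(1) by force
    ultimately show ?thesis using k by (meson less_trans)
  qed
  have "\<exists>n. from_nat_into D n \<in> M \<and> d x (from_nat_into D n) < \<epsilon> \<and> d (from_nat_into D n) x < \<epsilon>"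
    if "x \<in> M" "\<epsilon> > 0" for x \<epsilon>
    using dense[OF that] from_nat_into_surj[OF \<open>countable D\<close>] by blast
  then show ?thesis using that by blast
qed

text \<open>The pair \<open>(n, k)\<close> is the formal ball with centre \<open>c n\<close> and
  radius \<open>(1/2) ^ k\<close>, and \<open>prec\<close> is the strict order of formal balls.
  Chains have Cauchy centres, and their Smyth limit is the required point.\<close>

lemma quasi_Polish_convergent_base:
  assumes "quasi_Polish_space X"
  shows "\<exists>(B :: nat \<times> nat \<Rightarrow> 'a set) prec. convergent_base X B prec"
proof -
  define M where "M = topspace X"
  obtain d where qm: "quasi_metric_on M d" and smyth: "Smyth_complete_on M d"
    and top: "X = quasi_metric_topology M d" and sc: "second_countable X"
    using assms unfolding quasi_Polish_space_def M_def by blast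
  have d_nonneg: "0 \<le> d x y" if "x \<in> M" "y \<in> M" for x y
    using qm that unfolding quasi_metric_on_def by blast
  have d0: "d x x = 0" if "x \<in> M" for x
    using qm that unfolding quasi_metric_on_def by blast
  have tri: "d x z \<le> d x y + d y z" if "x \<in> M" "y \<in> M" "z \<in> M" for x y z
    using qm that unfolding quasi_metric_on_def by blast
  obtain c :: "nat \<Rightarrow> 'a" where
    c: "\<And>x \<epsilon>. x \<in> M \<Longrightarrow> \<epsilon> > 0 \<Longrightarrow> \<exists>n. c n \<in> M \<and> d x (c n) < \<epsilon> \<and> d (c n) x < \<epsilon>"
    using symmetrized_separable[OF qm] sc top by metis
  define r :: "nat \<times> nat \<Rightarrow> real" where "r b = (1/2) ^ snd b" for b
  define z where "z b = c (fst b)" for b :: "nat \<times> nat"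
  define B where "B b = {y\<in>M. z b \<in> M \<and> d (z b) y < r b}" for b
  define prec where "prec a b \<longleftrightarrow> z a \<in> M \<and> z b \<in> M \<and> d (z a) (z b) + r b < r a" for a b
  have opX: "openin X U \<longleftrightarrow> U \<subseteq> M \<and> (\<forall>x\<in>U. \<exists>\<epsilon>>0. {y\<in>M. d x y < \<epsilon>} \<subseteq> U)" for U
    unfolding top openin_quasi_metric_topology ..
  have "convergent_base X B prec"
  proof
    show "openin X (B b)" for b
      unfolding opX
    proof (intro conjI ballI)
      fix y assume y: "y \<in> B b"
      have "d (z b) w < r b" if "w \<in> M" "d y w < r b - d (z b) y" for w
        using tri[of "z b" y w] that y unfolding B_def by simp
      then show "\<exists>\<epsilon>>0. {w\<in>M. d y w < \<epsilon>} \<subseteq> B b"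
        using y unfolding B_def by (intro exI[of _ "r b - d (z b) y"]) auto
    qed (auto simp: B_def)
  next
    fix a b assume ab: "prec a b"
    show "B b \<subseteq> B a"
    proof
      fix y assume "y \<in> B b"
      then show "y \<in> B a"
        using ab tri[of "z a" "z b" y] unfolding B_def prec_def by auto
    qed
  next
    fix U x S
    assume U: "openin X U" "x \<in> U" and S: "finite S" "\<And>a. a \<in> S \<Longrightarrow> x \<in> B a"
    have x: "x \<in> M" using U opX by blast
    obtain \<epsilon> where \<epsilon>: "\<epsilon> > 0" "{y\<in>M. d x y < \<epsilon>} \<subseteq> U" using U opX by blast
    \<comment> \<open>The least room that \<open>x\<close> has in \<open>U\<close> and in the balls
      of \<open>S\<close>. Half of it is spent on the distance from \<open>x\<close> to the new
      centre, half on the new radius.\<close>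
    define \<delta> where "\<delta> = Min (insert \<epsilon> ((\<lambda>a. r a - d (z a) x) ` S))"
    have "\<delta> > 0" unfolding \<delta>_def using \<epsilon> S by (auto simp: B_def)
    have \<delta>: "\<delta> \<le> \<epsilon>" "\<And>a. a \<in> S \<Longrightarrow> \<delta> \<le> r a - d (z a) x"
      unfolding \<delta>_def using S(1) by auto
    obtain k where k: "(1/2) ^ k < \<delta> / 2"
      using real_arch_pow_inv[of "\<delta>/2" "1/2"] \<open>\<delta> > 0\<close> by auto
    obtain n where n: "c n \<in> M" "d x (c n) < (1/2) ^ k" "d (c n) x < (1/2) ^ k"
      using c[OF x, of "(1/2) ^ k"] by auto
    have "x \<in> B (n, k)" using x n by (simp add: B_def z_def r_def)
    moreover have "B (n, k) \<subseteq> U"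
    proof
      fix y assume "y \<in> B (n, k)"
      then have "y \<in> M" "d (c n) y < (1/2) ^ k" by (auto simp: B_def z_def r_def)
      then show "y \<in> U" using \<epsilon>(2) tri[of x "c n" y] x n k \<delta>(1) by auto
    qed
    moreover have "prec a (n, k)" if "a \<in> S" for a
    proof -
      have "z a \<in> M" using S(2)[OF that] by (simp add: B_def)
      then have "d (z a) (c n) \<le> d (z a) x + d x (c n)" using tri x n by blast
      then show ?thesis
        using \<delta>(2)[OF that] n k \<open>z a \<in> M\<close> by (simp add: prec_def z_def r_def)
    qed
    ultimately show "\<exists>b. x \<in> B b \<and> B b \<subseteq> U \<and> (\<forall>a\<in>S. prec a b)" by blast
  next
    fix p assume p: "\<And>k. prec (p k) (p (Suc k))"
    have zM: "z (p k) \<in> M" for k using p prec_def by blast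
    have step: "d (z (p k)) (z (p (Suc k))) + r (p (Suc k)) < r (p k)" for k
      using p prec_def by blast
    \<comment> \<open>Radii are powers of 1/2, so their strict decrease makes the natural exponents
      grow and the radii tend to 0.\<close>
    have "snd (p k) < snd (p (Suc k))" for k
    proof -
      have "r (p (Suc k)) < r (p k)" using step[of k] d_nonneg[OF zM zM, of k "Suc k"] by linarith
      then show ?thesis by (simp add: r_def power_strict_decreasing_iff)
    qed
    then have "k \<le> snd (p k)" for k
      by (intro strict_mono_imp_increasing) (simp add: strict_mono_Suc_iff)
    then have r_le: "r (p k) \<le> (1/2) ^ k" for k
      by (simp add: r_def power_decreasing)
    have r_pos: "r b > 0" for b by (simp add: r_def)
    have far: "d (z (p m)) (z (p n)) + r (p n) \<le> r (p m)" if "m \<le> n" for m n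
      using that
    proof (induction rule: dec_induct)
      case base
      then show ?case using d0 zM by simp
    next
      case (step n)
      then show ?case
        using tri[OF zM[of m] zM[of n] zM[of "Suc n"]] \<open>\<And>k. d (z (p k)) (z (p (Suc k))) + r (p (Suc k)) < r (p k)\<close>[of n]
        by linarith
    qed
    have "quasi_metric_Cauchy d (\<lambda>k. z (p k))"
      unfolding quasi_metric_Cauchy_def
    proof (intro allI impI)
      fix \<epsilon> :: real assume "\<epsilon> > 0"
      then obtain K where K: "(1/2) ^ K < \<epsilon>" using real_arch_pow_inv[of \<epsilon> "1/2"] by auto
      have "d (z (p m)) (z (p n)) < \<epsilon>" if "K \<le> m" "m \<le> n" for m n
      proof -
        have "(1/2 :: real) ^ m \<le> (1/2) ^ K" using that(1) by (simp add: power_decreasing)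
        then show ?thesis using far[OF that(2)] r_pos[of "p n"] r_le[of m] K by linarith
      qed
      then show "\<exists>K. \<forall>m n. K \<le> m \<and> m \<le> n \<longrightarrow> d (z (p m)) (z (p n)) < \<epsilon>" by blast
    qed
    then obtain x where x: "x \<in> M"
      and lim: "(\<lambda>k. max (d x (z (p k))) (d (z (p k)) x)) \<longlonglongrightarrow> 0"
      using smyth[unfolded Smyth_complete_on_def, rule_format, of "\<lambda>k. z (p k)"] zM by blast
    have near: "\<exists>k\<ge>m. d x (z (p k)) < \<epsilon> \<and> d (z (p k)) x < \<epsilon>" if "\<epsilon> > 0" for \<epsilon> m
    proof -
      have "\<forall>\<^sub>F k in sequentially. max (d x (z (p k))) (d (z (p k)) x) < \<epsilon>"
        using order_tendstoD(2)[OF lim that] .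
      then have "\<forall>\<^sub>F k in sequentially. k \<ge> m \<and> max (d x (z (p k))) (d (z (p k)) x) < \<epsilon>"
        using eventually_ge_at_top[of m] by eventually_elim simp
      then obtain k where "k \<ge> m" "max (d x (z (p k))) (d (z (p k)) x) < \<epsilon>"
        using eventually_happens'[OF sequentially_bot] by blast
      then show ?thesis by auto
    qed
    \<comment> \<open>Passing to the limit would only give distance at most the radius; the strict
      inequality between stages \<open>m\<close> and \<open>Suc m\<close> leaves the room
      \<delta>.\<close>
    have "x \<in> B (p m)" for m
    proof -
      define \<delta> where "\<delta> = r (p m) - (d (z (p m)) (z (p (Suc m))) + r (p (Suc m)))"
      have "\<delta> > 0" unfolding \<delta>_def using step[of m] by simp
      then obtain k where k: "k \<ge> Suc m" "d (z (p k)) x < \<delta>" using near by blast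
      have "d (z (p m)) x \<le> d (z (p m)) (z (p (Suc m))) + d (z (p (Suc m))) x"
        "d (z (p (Suc m))) x \<le> d (z (p (Suc m))) (z (p k)) + d (z (p k)) x"
        using tri zM x by blast+
      then have "d (z (p m)) x < r (p m)"
        using far[OF k(1)] k(2) r_pos[of "p k"] unfolding \<delta>_def by linarith
      then show ?thesis using x zM by (simp add: B_def)
    qed
    \<comment> \<open>Here the distance from \<open>x\<close> to the centres must be small, whereas
      membership above used the opposite direction: symmetrized convergence provides both.\<close>
    moreover have "\<exists>k. B (p k) \<subseteq> U" if U: "openin X U" "x \<in> U" for U
    proof -
      obtain \<epsilon> where \<epsilon>: "\<epsilon> > 0" "{y\<in>M. d x y < \<epsilon>} \<subseteq> U" using U opX by blast
      obtain m where m: "(1/2) ^ m < \<epsilon> / 2" using real_arch_pow_inv[of "\<epsilon>/2" "1/2"] \<epsilon>(1) by auto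
      obtain k where k: "k \<ge> m" "d x (z (p k)) < \<epsilon> / 2" using near[of "\<epsilon>/2" m] \<epsilon>(1) by auto
      have "(1/2 :: real) ^ k \<le> (1/2) ^ m" using k(1) by (simp add: power_decreasing)
      then have rk: "r (p k) < \<epsilon> / 2" using r_le[of k] m by linarith
      have "B (p k) \<subseteq> U"
      proof
        fix y assume "y \<in> B (p k)"
        then have y: "y \<in> M" "d (z (p k)) y < r (p k)" unfolding B_def by auto
        then have "d x y < \<epsilon>" using tri[OF x zM[of k], of y] rk k(2) by linarith
        then show "y \<in> U" using y(1) \<epsilon>(2) by blast
      qed
      then show ?thesis by blast
    qed
    ultimately show "\<exists>x. chain_limit X B p x"
      unfolding chain_limit_def by blast
  qed
  then show ?thesis by blast
qed

theorem theorem5p1: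
  fixes X :: "'a topology"
  assumes "quasi_Polish_space X"
  shows "quasi_Polish_space (convex_powerspace X)"
  using quasi_Polish_convergent_base[OF assms] convergent_base.quasi_Polish_convex_powerspace
  by blast

end
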